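(* Let $\Theta\subset\mathbb{R}^l$ be a closed convex set with $\bar z\in\Theta$, and let $\Theta$ be cone reducible at $\bar z$. If $\Theta$ satisfies the extended polyhedricity condition at $\bar z$, then $\Theta$ satisfies the projection derivation condition at $\bar z$.
   Context: Notation: $P_\Omega$ is the Euclidean metric projection onto a closed convex set $\Omega$; $f'(x;h)$ is the classical directional derivative of $f$ at $x$ in direction $h$; $N_\Theta(\bar z)$ is the normal cone of convex analysis. Tangent cone: $T_\Omega(\bar z):=\{z\mid\exists\,t_k\downarrow0,\ z_k\to z\text{ with }\bar z+t_kz_k\in\Omega\}$. Cone reducibility: $\Theta$ is cone reducible at $\bar z$ if there exist a pointed closed convex cone $\Xi\subset\mathbb{R}^q$, a neighborhood $V$ of $\bar z$ and a $\mathcal{C}^2$-smooth mapping $\eta:V\to\mathbb{R}^q$ such that for all $z\in V$ one has $z\in\Theta$ if and only if $\eta(z)\in\Xi$, $\eta(\bar z)=0$, and $\nabla\eta(\bar z):\mathbb{R}^l\to\mathbb{R}^q$ is surjective. Critical cone: $\mathcal{K}(\bar z,b):=T_\Theta(\bar z)\cap\{b\}^\perp$ for $b\in\mathbb{R}^l$. (Inner) second-order tangent set of $\Theta$ at $\bar z$ in direction $h\in T_\Theta(\bar z)$: $T^2_\Theta(\bar z,h):=\{w\in\mathbb{R}^l\mid\operatorname{dist}(\bar z+th+\tfrac12t^2w;\Theta)=o(t^2),\ t>0\}$, where $o(t^2)$ is understood as $t\downarrow0$. Second-order critical set: $\mathcal{K}^2(\bar z,b):=\{h\in\mathcal{K}(\bar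 z,b)\mid0\in T^2_\Theta(\bar z,h)\}$ for $b\in N_\Theta(\bar z)$. Extended polyhedricity condition at $\bar z$: for every $b\in N_\Theta(\bar z)$ the set $\mathcal{K}^2(\bar z,b)$ is a dense subset of $\mathcal{K}(\bar z,b)$. Projection derivation condition (PDC) at $\bar z$: $P'_\Theta(\bar z+b;h)=P_{\mathcal{K}(\bar z,b)}(h)$ for all $b\in N_\Theta(\bar z)$ and all $h\in\mathbb{R}^l$ (in particular the directional derivatives on the left exist). *)

theory Defs
  imports "HOL-Analysis.Analysis" "HOL-Library.Landau_Symbols"
begin

definition tangent_cone :: "'a::euclidean_space set \<Rightarrow> 'a \<Rightarrow> 'a set" where
  "tangent_cone \<Theta> zb = {z. \<exists>(t :: nat \<Rightarrow> real) (zs :: nat \<Rightarrow> 'a).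
     (\<forall>k. 0 < t k) \<and> t \<longlonglongrightarrow> 0 \<and> zs \<longlonglongrightarrow> z \<and> (\<forall>k. zb + t k *\<^sub>R zs k \<in> \<Theta>)}"

definition normal_cone :: "'a::euclidean_space set \<Rightarrow> 'a \<Rightarrow> 'a set" where
  "normal_cone \<Theta> zb = {b. zb \<in> \<Theta> \<and> (\<forall>z\<in>\<Theta>. b \<bullet> (z - zb) \<le> 0)}"

definition critical_cone :: "'a::euclidean_space set \<Rightarrow> 'a \<Rightarrow> 'a \<Rightarrow> 'a set" where
  "critical_cone \<Theta> zb b = tangent_cone \<Theta> zb \<inter> {b}\<^sup>\<bottom>"

definition second_order_tangent_set :: "'a::euclidean_space set \<Rightarrow> 'a \<Rightarrow> 'a \<Rightarrow> 'a set" where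
  "second_order_tangent_set \<Theta> zb h =
     {w. (\<lambda>t::real. infdist (zb + t *\<^sub>R h + (t\<^sup>2 / 2) *\<^sub>R w) \<Theta>) \<in> o[at_right 0](\<lambda>t. t\<^sup>2)}"

definition second_order_critical_set :: "'a::euclidean_space set \<Rightarrow> 'a \<Rightarrow> 'a \<Rightarrow> 'a set" where
  "second_order_critical_set \<Theta> zb b =
     {h \<in> critical_cone \<Theta> zb b. 0 \<in> second_order_tangent_set \<Theta> zb h}"

definition extended_polyhedricity_at :: "'a::euclidean_space set \<Rightarrow> 'a \<Rightarrow> bool" where
  "extended_polyhedricity_at \<Theta> zb \<longleftrightarrow>
     (\<forall>b\<in>normal_cone \<Theta> zb.
        second_order_critical_set \<Theta> zb b \<subseteq> critical_cone \<Theta> zb b \<and>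
        critical_cone \<Theta> zb b \<subseteq> closure (second_order_critical_set \<Theta> zb b))"

definition has_directional_derivative ::
    "('a::real_normed_vector \<Rightarrow> 'b::real_normed_vector) \<Rightarrow> 'b \<Rightarrow> 'a \<Rightarrow> 'a \<Rightarrow> bool" where
  "has_directional_derivative f d x h \<longleftrightarrow>
     ((\<lambda>t::real. (1 / t) *\<^sub>R (f (x + t *\<^sub>R h) - f x)) \<longlongrightarrow> d) (at_right 0)"

definition projection_derivation_condition_at :: "'a::euclidean_space set \<Rightarrow> 'a \<Rightarrow> bool" where
  "projection_derivation_condition_at \<Theta> zb \<longleftrightarrow>
     (\<forall>b\<in>normal_cone \<Theta> zb. \<forall>h.
        has_directional_derivative (closest_point \<Theta>)
          (closest_point (critical_cone \<Theta> zb b) h) (zb + b) h)"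

definition C2_smooth_on :: "('a::real_normed_vector \<Rightarrow> 'b::real_normed_vector) \<Rightarrow> 'a set \<Rightarrow> bool" where
  "C2_smooth_on f V \<longleftrightarrow>
     (\<exists>(f' :: 'a \<Rightarrow> 'a \<Rightarrow>\<^sub>L 'b) (f'' :: 'a \<Rightarrow> 'a \<Rightarrow>\<^sub>L ('a \<Rightarrow>\<^sub>L 'b)).
        (\<forall>x\<in>V. (f has_derivative blinfun_apply (f' x)) (at x)) \<and>
        (\<forall>x\<in>V. (f' has_derivative blinfun_apply (f'' x)) (at x)) \<and>
        continuous_on V f'')"

definition pointed_closed_convex_cone :: "'a::euclidean_space set \<Rightarrow> bool" where
  "pointed_closed_convex_cone \<Xi> \<longleftrightarrow>
     cone \<Xi> \<and> closed \<Xi> \<and> convex \<Xi> \<and> \<Xi> \<inter> uminus ` \<Xi> = {0}"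

(* The reduction (Xi, V, eta) with the subspace W in the role of R^q, q = dim W. *)
definition cone_reduction ::
    "'a::euclidean_space set \<Rightarrow> 'a \<Rightarrow> 'b::euclidean_space set \<Rightarrow> 'b set \<Rightarrow> 'a set \<Rightarrow> ('a \<Rightarrow> 'b) \<Rightarrow> bool" where
  "cone_reduction \<Theta> zb W \<Xi> V \<eta> \<longleftrightarrow>
     subspace W \<and> \<Xi> \<subseteq> W \<and> pointed_closed_convex_cone \<Xi> \<and>
     open V \<and> zb \<in> V \<and> \<eta> ` V \<subseteq> W \<and> C2_smooth_on \<eta> V \<and>
     (\<forall>z\<in>V. z \<in> \<Theta> \<longleftrightarrow> \<eta> z \<in> \<Xi>) \<and>
     \<eta> zb = 0 \<and>
     range (frechet_derivative \<eta> (at zb)) = W"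

(* The dimension q is existentially quantified in the notion of cone reducibility.  Surjectivity of
   the derivative forces q <= l, so R^q may be taken to be a linear subspace W of R^l.  Unlike a
   Euclidean type this includes q = 0, which is the case needed when zb is interior to Theta.
   The lemma below confirms that any reduction into a Euclidean space is covered. *)
definition cone_reducible_at :: "'a::euclidean_space set \<Rightarrow> 'a \<Rightarrow> bool" where
  "cone_reducible_at \<Theta> zb \<longleftrightarrow>
     (\<exists>(W :: 'a set) \<Xi> V (\<eta> :: 'a \<Rightarrow> 'a). cone_reduction \<Theta> zb W \<Xi> V \<eta>)"

lemma C2_smooth_on_bounded_linear_compose:
  fixes f :: "'a::real_normed_vector \<Rightarrow> 'b::real_normed_vector"
    and j :: "'b \<Rightarrow> 'c::real_normed_vector"
  assumes "bounded_linear j" "C2_smooth_on f V"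
  shows "C2_smooth_on (\<lambda>x. j (f x)) V"
proof -
  from assms(2) obtain f' f'' where
    f: "\<And>x. x \<in> V \<Longrightarrow> (f has_derivative blinfun_apply (f' x)) (at x)"
      "\<And>x. x \<in> V \<Longrightarrow> (f' has_derivative blinfun_apply (f'' x)) (at x)"
      "continuous_on V f''"
    unfolding C2_smooth_on_def by blast
  define J where "J = Blinfun j"
  have J: "blinfun_apply J = j"
    by (simp add: J_def assms(1) bounded_linear_Blinfun_apply)
  have bJ: "bounded_linear (blinfun_compose J)"
    by (rule bounded_bilinear.bounded_linear_right[OF bounded_bilinear_blinfun_compose])
  define JJ where "JJ = Blinfun (blinfun_compose J :: ('a \<Rightarrow>\<^sub>L 'b) \<Rightarrow> _)"
  have JJ: "blinfun_apply JJ = blinfun_compose J"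
    by (simp add: JJ_def bJ bounded_linear_Blinfun_apply)
  have bJJ: "bounded_linear (blinfun_compose JJ)"
    by (rule bounded_bilinear.bounded_linear_right[OF bounded_bilinear_blinfun_compose])
  have 1: "((\<lambda>x. j (f x)) has_derivative blinfun_apply (J o\<^sub>L f' x)) (at x)" if "x \<in> V" for x
    using bounded_linear.has_derivative[OF assms(1) f(1)[OF that]] by (simp add: blinfun_compose.rep_eq J comp_def)
  have 2: "((\<lambda>x. J o\<^sub>L f' x) has_derivative blinfun_apply (JJ o\<^sub>L f'' x)) (at x)" if "x \<in> V" for x
    using bounded_linear.has_derivative[OF bJ f(2)[OF that]] by (simp add: blinfun_compose.rep_eq JJ comp_def)
  have 3: "continuous_on V (\<lambda>x. JJ o\<^sub>L f'' x)"
    by (rule bounded_linear.continuous_on[OF bJJ f(3)])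
  show ?thesis
    unfolding C2_smooth_on_def
    by (rule exI[of _ "\<lambda>x. J o\<^sub>L f' x"], rule exI[of _ "\<lambda>x. JJ o\<^sub>L f'' x"]) (use 1 2 3 in blast)
qed

lemma cone_reducible_atI:
  fixes \<eta> :: "'a::euclidean_space \<Rightarrow> 'b::euclidean_space"
  assumes "cone_reduction \<Theta> zb UNIV \<Xi> V \<eta>"
  shows "cone_reducible_at \<Theta> zb"
proof -
  define D where "D = frechet_derivative \<eta> (at zb)"
  from assms have A: "cone \<Xi>" "closed \<Xi>" "convex \<Xi>" "\<Xi> \<inter> uminus ` \<Xi> = {0}"
    "open V" "zb \<in> V" "C2_smooth_on \<eta> V" "\<forall>z\<in>V. z \<in> \<Theta> \<longleftrightarrow> \<eta> z \<in> \<Xi>" "\<eta> zb = 0" "surj D"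
    unfolding cone_reduction_def pointed_closed_convex_cone_def D_def by auto
  have "\<eta> differentiable at zb"
    using A(6,7) unfolding C2_smooth_on_def differentiable_def by blast
  then have D: "(\<eta> has_derivative D) (at zb)"
    unfolding D_def using frechet_derivative_works by blast
  obtain j where j: "linear j" "D \<circ> j = id"
    using linear_surjective_right_inverse[OF has_derivative_linear[OF D] A(10)] by blast
  have inj: "inj j"
    using j(2) by (metis inj_on_id inj_on_imageI2)
  have bj: "bounded_linear j"
    using j(1) by (simp add: linear_conv_bounded_linear)
  have der: "frechet_derivative (\<lambda>x. j (\<eta> x)) (at zb) = (\<lambda>x. j (D x))"
    using bounded_linear.has_derivative[OF bj D] frechet_derivative_at by metis
  have pc: "pointed_closed_convex_cone (j ` \<Xi>)"
    unfolding pointed_closed_convex_cone_def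
  proof (intro conjI)
    show "cone (j ` \<Xi>)"
      unfolding cone_def
    proof (clarify)
      fix x and c :: real
      assume "x \<in> \<Xi>" "0 \<le> c"
      then have "c *\<^sub>R x \<in> \<Xi>" using A(1) by (simp add: cone_def)
      then show "c *\<^sub>R j x \<in> j ` \<Xi>" using linear_scale[OF j(1)] by (metis imageI)
    qed
    show "closed (j ` \<Xi>)"
      using closed_injective_linear_image[OF A(2) j(1) inj] .
    show "convex (j ` \<Xi>)"
      using convex_linear_image[OF j(1) A(3)] .
    have "uminus ` j ` \<Xi> = j ` uminus ` \<Xi>"
      by (simp add: image_image linear_neg[OF j(1)])
    then show "j ` \<Xi> \<inter> uminus ` j ` \<Xi> = {0}"
      using A(4) image_Int[OF inj, of \<Xi> "uminus ` \<Xi>"] linear_0[OF j(1)] by simp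
  qed
  have "cone_reduction \<Theta> zb (range j) (j ` \<Xi>) V (\<lambda>x. j (\<eta> x))"
    unfolding cone_reduction_def
  proof (intro conjI)
    show "subspace (range j)"
      using linear_subspace_image[OF j(1)] by simp
    show "C2_smooth_on (\<lambda>x. j (\<eta> x)) V"
      by (rule C2_smooth_on_bounded_linear_compose[OF bj A(7)])
    show "\<forall>z\<in>V. (z \<in> \<Theta>) = (j (\<eta> z) \<in> j ` \<Xi>)"
      using A(8) inj by (simp add: inj_image_mem_iff)
    show "range (frechet_derivative (\<lambda>x. j (\<eta> x)) (at zb)) = range j"
      unfolding der using A(10) by (metis image_image)
  qed (use A pc linear_0[OF j(1)] in auto)
  then show ?thesis
    unfolding cone_reducible_at_def by blast
qed

end

theory Submission
  imports Defs
begin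

text \<open>
  Write \<open>z\<^sub>t\<close> for the projection of \<open>zb + b + t h\<close> onto \<open>\<Theta>\<close>, and
  \<open>d\<^sub>t = (z\<^sub>t - zb) / t\<close>. Since \<open>zb\<close> is the projection of \<open>zb + b\<close>, the claim is that \<open>d\<^sub>t\<close>
  tends to the projection of \<open>h\<close> onto the critical cone \<open>K\<close>. After rescaling and dropping a
  constant, the minimality of \<open>z\<^sub>t\<close> says that \<open>d\<^sub>t\<close> minimises the penalised distance
  \<open>\<phi>\<^sub>t(e) = |e - h|\<^sup>2 - (2/t) \<langle>b, e\<rangle>\<close> over \<open>(\<Theta> - zb) / t\<close>
  (\<open>closest_point_quotient_minimises\<close>), and the penalty is nonnegative there because \<open>b\<close> is normal.

  Comparing \<open>d\<^sub>t\<close> with \<open>e = 0\<close> shows that \<open>d\<^sub>t\<close> is bounded and that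
  \<open>\<langle>b, d\<^sub>t\<rangle> = O(t)\<close>, so every cluster point \<open>d\<close> lies in the tangent cone and is orthogonal to
  \<open>b\<close>: it lies in \<open>K\<close>. If \<open>k \<in> K\<close> and \<open>0\<close> is a second-order tangent in direction \<open>k\<close>,
  then \<open>\<Theta>\<close> contains points \<open>zb + t k + o(t\<^sup>2)\<close>; as \<open>\<langle>b, k\<rangle> = 0\<close>, their penalty vanishes in the
  limit and \<open>\<phi>\<^sub>t\<close> tends to \<open>|k - h|\<^sup>2\<close> along them (\<open>second_order_critical_recovery\<close>).
  Hence \<open>|d - h| \<le> |k - h|\<close> for all such \<open>k\<close>, and by extended polyhedricity for all
  \<open>k \<in> K\<close>. So \<open>d\<close> is the projection of \<open>h\<close> onto \<open>K\<close>, the only possible cluster point of the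
  bounded family \<open>d\<^sub>t\<close>.
\<close>

section \<open>Tangent and critical cones of a convex set\<close>

lemma convex_tangent_cone_eq_closure:
  fixes \<Theta> :: "'a::euclidean_space set"
  assumes "convex \<Theta>" and "zb \<in> \<Theta>"
  shows "tangent_cone \<Theta> zb = closure {s *\<^sub>R (z - zb) |s z. 0 < s \<and> z \<in> \<Theta>}" (is "_ = closure ?C")
proof (intro set_eqI iffI)
  fix x assume "x \<in> tangent_cone \<Theta> zb"
  then obtain t :: "nat \<Rightarrow> real" and zs where
    t: "\<forall>k. 0 < t k" and zs: "zs \<longlonglongrightarrow> x" and mem: "\<forall>k. zb + t k *\<^sub>R zs k \<in> \<Theta>"
    unfolding tangent_cone_def by blast
  have "zs k \<in> ?C" for k
  proof -
    have "zs k = (1 / t k) *\<^sub>R ((zb + t k *\<^sub>R zs k) - zb)"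
      using t[rule_format, of k] by simp
    moreover have "0 < 1 / t k"
      using t by simp
    ultimately show ?thesis
      using mem by blast
  qed
  then show "x \<in> closure ?C"
    using zs closure_sequential by blast
next
  fix x assume "x \<in> closure ?C"
  then obtain c where c: "\<forall>k. c k \<in> ?C" "c \<longlonglongrightarrow> x"
    unfolding closure_sequential by blast
  then have "\<forall>k. \<exists>s z. c k = s *\<^sub>R (z - zb) \<and> 0 < s \<and> z \<in> \<Theta>"
    by blast
  then obtain s z where sz: "\<And>k. c k = s k *\<^sub>R (z k - zb)" "\<And>k. 0 < s k" "\<And>k. z k \<in> \<Theta>"
    by metis
  \<comment> \<open>The scaling makes \<open>t k * s k \<le> 1\<close>, so the points stay on segments from \<open>zb\<close> inside \<open>\<Theta>\<close>.\<close>
  define t where "t k = inverse (real (Suc k)) * (1 / (1 + s k))" for k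
  have tpos: "0 < t k" for k
    using sz(2)[of k] by (simp add: t_def add_pos_pos)
  have "t k \<le> inverse (real (Suc k))" for k
    unfolding t_def using sz(2)[of k] by (intro mult_left_le) auto
  then have t0: "t \<longlonglongrightarrow> 0"
    by (intro tendsto_sandwich[OF always_eventually always_eventually tendsto_const
          LIMSEQ_inverse_real_of_nat] allI less_imp_le[OF tpos])
  have "zb + t k *\<^sub>R c k \<in> \<Theta>" for k
  proof -
    have "t k * s k = inverse (real (Suc k)) * (s k / (1 + s k))"
      by (simp add: t_def)
    also have "\<dots> \<le> 1"
      using sz(2)[of k] by (intro mult_le_one) (auto simp: field_simps)
    finally have le: "t k * s k \<le> 1" .
    have "0 \<le> t k * s k"
      using tpos[of k] sz(2)[of k] by simp
    then have "(1 - t k * s k) *\<^sub>R zb + (t k * s k) *\<^sub>R z k \<in> \<Theta>"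
      using le assms sz(3)[of k] by (intro convexD_alt) auto
    then show ?thesis
      by (simp add: sz(1) algebra_simps)
  qed
  then show "x \<in> tangent_cone \<Theta> zb"
    unfolding tangent_cone_def
    by (intro CollectI exI[of _ t] exI[of _ c] conjI allI tpos t0 c(2))
qed

lemma convex_scaled_differences:
  fixes \<Theta> :: "'a::real_vector set"
  assumes "convex \<Theta>"
  shows "convex {s *\<^sub>R (z - zb) |s z. 0 < s \<and> z \<in> \<Theta>}" (is "convex ?C")
proof (rule convexI)
  fix x y and u v :: real
  assume "x \<in> ?C" "y \<in> ?C" and uv: "0 \<le> u" "0 \<le> v" "u + v = 1"
  then obtain r z s w where
    x: "x = r *\<^sub>R (z - zb)" "0 < r" "z \<in> \<Theta>" and y: "y = s *\<^sub>R (w - zb)" "0 < s" "w \<in> \<Theta>"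
    by blast
  define q where "q = u * r + v * s"
  have q: "0 < q"
  proof (cases "u = 0")
    case True
    then show ?thesis using uv y(2) by (simp add: q_def)
  next
    case False
    then have "0 < u * r" using uv x(2) by simp
    then show ?thesis using uv y(2) by (simp add: q_def add_pos_nonneg)
  qed
  have "(u * r / q) *\<^sub>R z + (v * s / q) *\<^sub>R w \<in> \<Theta>"
    using assms x y uv q
    by (intro convexD) (auto simp: q_def add_divide_distrib[symmetric])
  moreover have "u *\<^sub>R x + v *\<^sub>R y = q *\<^sub>R ((u * r / q) *\<^sub>R z + (v * s / q) *\<^sub>R w - zb)"
    using q by (simp add: x(1) y(1) algebra_simps) (simp add: q_def algebra_simps)
  ultimately show "u *\<^sub>R x + v *\<^sub>R y \<in> ?C"
    using q by blast
qed

lemma critical_cone_iff: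
  "d \<in> critical_cone \<Theta> zb b \<longleftrightarrow> d \<in> tangent_cone \<Theta> zb \<and> b \<bullet> d = 0"
  by (auto simp: critical_cone_def orthogonal_comp_def orthogonal_def inner_commute)

lemma closed_convex_critical_cone:
  fixes \<Theta> :: "'a::euclidean_space set"
  assumes "convex \<Theta>" and "zb \<in> \<Theta>"
  shows "closed (critical_cone \<Theta> zb b)" and "convex (critical_cone \<Theta> zb b)"
proof -
  have eq: "critical_cone \<Theta> zb b = tangent_cone \<Theta> zb \<inter> {d. b \<bullet> d = 0}"
    by (auto simp: critical_cone_iff)
  show "closed (critical_cone \<Theta> zb b)"
    unfolding eq convex_tangent_cone_eq_closure[OF assms]
    by (intro closed_Int closed_closure closed_hyperplane)
  show "convex (critical_cone \<Theta> zb b)"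
    unfolding eq convex_tangent_cone_eq_closure[OF assms]
    by (intro convex_Int convex_closure convex_scaled_differences assms convex_hyperplane)
qed

section \<open>Difference quotients of the projection\<close>

lemma closest_point_add_normal:
  fixes \<Theta> :: "'a::euclidean_space set"
  assumes "closed \<Theta>" and "convex \<Theta>" and "b \<in> normal_cone \<Theta> zb"
  shows "closest_point \<Theta> (zb + b) = zb"
proof -
  have zb: "zb \<in> \<Theta>" and b: "\<And>z. z \<in> \<Theta> \<Longrightarrow> b \<bullet> (z - zb) \<le> 0"
    using assms(3) by (auto simp: normal_cone_def)
  have "dist (zb + b) zb \<le> dist (zb + b) z" if "z \<in> \<Theta>" for z
  proof -
    have "(norm (zb + b - z))\<^sup>2 = (norm b)\<^sup>2 - 2 * (b \<bullet> (z - zb)) + (norm (z - zb))\<^sup>2"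
      by (simp add: power2_norm_eq_inner inner_diff inner_add inner_commute)
    then have "(norm b)\<^sup>2 \<le> (norm (zb + b - z))\<^sup>2"
      using b[OF that] zero_le_power2[of "norm (z - zb)"] by linarith
    then have "norm b \<le> norm (zb + b - z)"
      by (rule power2_le_imp_le) simp
    then show ?thesis
      by (simp add: dist_norm)
  qed
  then show ?thesis
    using closest_point_unique[OF assms(2,1) zb] by auto
qed

text \<open>The minimality of the projection of \<open>zb + b + t h\<close>, expressed in difference quotients from
  \<open>zb\<close>. The squared distances have been divided by \<open>t\<^sup>2\<close>, after removal of the term
  \<open>|b|\<^sup>2 + 2 t \<langle>b, h\<rangle>\<close> common to both sides.\<close>

lemma closest_point_quotient_minimises:
  fixes \<Theta> :: "'a::euclidean_space set" and t :: real
  assumes "closed \<Theta>" and "zb + t *\<^sub>R e \<in> \<Theta>" and "0 < t"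
    and "closest_point \<Theta> (zb + b + t *\<^sub>R h) = zb + t *\<^sub>R d"
  shows "(norm (d - h))\<^sup>2 - 2 / t * (b \<bullet> d) \<le> (norm (e - h))\<^sup>2 - 2 / t * (b \<bullet> e)"
proof -
  have expand: "(norm (zb + b + t *\<^sub>R h - (zb + t *\<^sub>R x)))\<^sup>2
      = t\<^sup>2 * ((norm (x - h))\<^sup>2 - 2 / t * (b \<bullet> x)) + ((norm b)\<^sup>2 + 2 * t * (b \<bullet> h))" for x
  proof -
    have "zb + b + t *\<^sub>R h - (zb + t *\<^sub>R x) = b - t *\<^sub>R (x - h)"
      by (simp add: algebra_simps)
    then have "(norm (zb + b + t *\<^sub>R h - (zb + t *\<^sub>R x)))\<^sup>2 = (norm (b - t *\<^sub>R (x - h)))\<^sup>2"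
      by (rule arg_cong)
    also have "\<dots> = (norm b)\<^sup>2 - 2 * t * (b \<bullet> (x - h)) + t\<^sup>2 * (norm (x - h))\<^sup>2"
      unfolding power2_norm_eq_inner
      by (simp add: inner_diff_left inner_diff_right inner_commute algebra_simps power2_eq_square)
    also have "\<dots> = t\<^sup>2 * ((norm (x - h))\<^sup>2 - 2 / t * (b \<bullet> x)) + ((norm b)\<^sup>2 + 2 * t * (b \<bullet> h))"
      using assms(3) by (simp add: inner_diff_right right_diff_distrib power2_eq_square)
    finally show ?thesis .
  qed
  have "dist (zb + b + t *\<^sub>R h) (zb + t *\<^sub>R d) \<le> dist (zb + b + t *\<^sub>R h) (zb + t *\<^sub>R e)"
    using closest_point_le[OF assms(1,2), of "zb + b + t *\<^sub>R h"] assms(4) by simp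
  then have "(norm (zb + b + t *\<^sub>R h - (zb + t *\<^sub>R d)))\<^sup>2 \<le> (norm (zb + b + t *\<^sub>R h - (zb + t *\<^sub>R e)))\<^sup>2"
    unfolding dist_norm by (rule power_mono) simp
  then show ?thesis
    unfolding expand using assms(3) by simp
qed

text \<open>Directions in the second-order critical set admit feasible quotients along which the
  penalised distance converges. This is where the rate \<open>o(t\<^sup>2)\<close>, rather than \<open>o(t)\<close>, is needed.\<close>

lemma second_order_critical_recovery:
  fixes \<Theta> :: "'a::euclidean_space set"
  assumes "closed \<Theta>" and "zb \<in> \<Theta>" and "k \<in> second_order_critical_set \<Theta> zb b"
  obtains e :: "real \<Rightarrow> 'a"
  where "\<And>t. 0 < t \<Longrightarrow> zb + t *\<^sub>R e t \<in> \<Theta>"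
    and "((\<lambda>t. (norm (e t - h))\<^sup>2 - 2 / t * (b \<bullet> e t)) \<longlongrightarrow> (norm (k - h))\<^sup>2) (at_right 0)"
proof -
  have bk: "b \<bullet> k = 0"
    and small: "(\<lambda>t::real. infdist (zb + t *\<^sub>R k) \<Theta>) \<in> o[at_right 0](\<lambda>t. t\<^sup>2)"
    using assms(3)
    by (auto simp: second_order_critical_set_def second_order_tangent_set_def critical_cone_iff)
  define y where "y t = closest_point \<Theta> (zb + t *\<^sub>R k)" for t
  define r where "r t = (1 / t\<^sup>2) *\<^sub>R (y t - (zb + t *\<^sub>R k))" for t
  define e where "e t = k + t *\<^sub>R r t" for t
  have ymem: "y t \<in> \<Theta>" for t
    unfolding y_def using assms(1,2) by (intro closest_point_in_set) auto
  have ye: "zb + t *\<^sub>R e t = y t" if "0 < t" for t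
    using that by (simp add: e_def r_def algebra_simps power2_eq_square)
  have pos: "\<forall>\<^sub>F t::real in at_right 0. 0 < t"
    by (simp add: eventually_at_right_less)
  have "norm (y t - (zb + t *\<^sub>R k)) = infdist (zb + t *\<^sub>R k) \<Theta>" for t
  proof -
    have "infdist (zb + t *\<^sub>R k) \<Theta> = dist (zb + t *\<^sub>R k) (y t)"
      using assms(1,2) setdist_closest_point[of \<Theta> "zb + t *\<^sub>R k"]
      by (auto simp: infdist_eq_setdist y_def)
    then show ?thesis
      by (simp add: dist_norm norm_minus_commute)
  qed
  then have "norm (r t) = infdist (zb + t *\<^sub>R k) \<Theta> / t\<^sup>2" for t
    by (simp add: r_def)
  moreover have "((\<lambda>t. infdist (zb + t *\<^sub>R k) \<Theta> / t\<^sup>2) \<longlongrightarrow> 0) (at_right 0)"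
    using smalloD_tendsto[OF small] .
  ultimately have "((\<lambda>t. norm (r t)) \<longlongrightarrow> 0) (at_right 0)"
    by (simp only:)
  then have r0: "(r \<longlongrightarrow> 0) (at_right 0)"
    by (rule tendsto_norm_zero_cancel)
  have "((\<lambda>t. (norm (k + t *\<^sub>R r t - h))\<^sup>2 - 2 * (b \<bullet> r t)) \<longlongrightarrow> (norm (k + 0 *\<^sub>R 0 - h))\<^sup>2 - 2 * (b \<bullet> 0))
      (at_right 0)"
    by (intro tendsto_intros r0)
  then have lim: "((\<lambda>t. (norm (e t - h))\<^sup>2 - 2 * (b \<bullet> r t)) \<longlongrightarrow> (norm (k - h))\<^sup>2) (at_right 0)"
    by (simp add: e_def)
  \<comment> \<open>Orthogonality of \<open>b\<close> and \<open>k\<close> cancels the term of order \<open>1/t\<close> in the penalty.\<close>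
  have "\<forall>\<^sub>F t in at_right 0.
      (norm (e t - h))\<^sup>2 - 2 * (b \<bullet> r t) = (norm (e t - h))\<^sup>2 - 2 / t * (b \<bullet> e t)"
    using pos by eventually_elim (simp add: e_def inner_add_right bk)
  then have "((\<lambda>t. (norm (e t - h))\<^sup>2 - 2 / t * (b \<bullet> e t)) \<longlongrightarrow> (norm (k - h))\<^sup>2) (at_right 0)"
    by (rule Lim_transform_eventually[OF lim])
  then show thesis
    using that[of e] ye ymem by simp
qed

section \<open>Convergence of the quotients\<close>

lemma tendsto_at_right_if_unique_cluster_point:
  fixes f :: "real \<Rightarrow> 'a::euclidean_space"
  assumes bdd: "bounded (f ` {0<..})"
    and cluster: "\<And>t d. \<lbrakk>\<And>n::nat. 0 < t n; t \<longlonglongrightarrow> 0; (\<lambda>n. f (t n)) \<longlonglongrightarrow> d\<rbrakk> \<Longrightarrow> d = p"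
  shows "(f \<longlongrightarrow> p) (at_right 0)"
proof (rule ccontr)
  assume "\<not> (f \<longlongrightarrow> p) (at_right 0)"
  then obtain \<epsilon> where \<epsilon>: "0 < \<epsilon>" "\<not> (\<forall>\<^sub>F t in at_right 0. dist (f t) p < \<epsilon>)"
    unfolding tendsto_iff by blast
  have "\<exists>t. 0 < t \<and> t < inverse (real (Suc n)) \<and> \<epsilon> \<le> dist (f t) p" for n
  proof (rule ccontr)
    assume "\<not> ?thesis"
    then have "\<forall>t>0. t < inverse (real (Suc n)) \<longrightarrow> dist (f t) p < \<epsilon>"
      by (auto simp: not_le)
    then have "\<forall>\<^sub>F t in at_right 0. dist (f t) p < \<epsilon>"
      unfolding eventually_at_right_field
      by (intro exI[of _ "inverse (real (Suc n))"]) simp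
    then show False
      using \<epsilon>(2) by blast
  qed
  then obtain t where t: "\<And>n. 0 < t n" "\<And>n. t n < inverse (real (Suc n))"
      "\<And>n. \<epsilon> \<le> dist (f (t n)) p"
    by metis
  have t0: "t \<longlonglongrightarrow> 0"
    by (intro tendsto_sandwich[OF always_eventually always_eventually tendsto_const
          LIMSEQ_inverse_real_of_nat] allI less_imp_le t(1,2))
  have "bounded (range (\<lambda>n. f (t n)))"
    by (rule bounded_subset[OF bdd]) (use t(1) in auto)
  then obtain d and \<rho> :: "nat \<Rightarrow> nat" where \<rho>: "strict_mono \<rho>" "((\<lambda>n. f (t n)) \<circ> \<rho>) \<longlonglongrightarrow> d"
    using bounded_imp_convergent_subsequence by blast
  then have lim: "(\<lambda>n. f (t (\<rho> n))) \<longlonglongrightarrow> d"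
    by (simp add: comp_def)
  have "d = p"
    using cluster[of "\<lambda>n. t (\<rho> n)" d] t(1) lim LIMSEQ_subseq_LIMSEQ[OF t0 \<rho>(1)]
    by (simp add: comp_def)
  then have "(\<lambda>n. dist (f (t (\<rho> n))) p) \<longlonglongrightarrow> 0"
    using lim by (simp add: tendsto_dist_iff[symmetric])
  then have "\<epsilon> \<le> 0"
    by (rule LIMSEQ_le_const) (use t(3) in auto)
  then show False
    using \<epsilon>(1) by simp
qed

theorem proposition4p2:
  fixes \<Theta> :: "'a::euclidean_space set" and zb :: 'a
  assumes "closed \<Theta>" and "convex \<Theta>" and "zb \<in> \<Theta>"
    and "cone_reducible_at \<Theta> zb"
    and "extended_polyhedricity_at \<Theta> zb"
  shows "projection_derivation_condition_at \<Theta> zb"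
  unfolding projection_derivation_condition_at_def
proof (intro ballI allI)
  fix b h assume b: "b \<in> normal_cone \<Theta> zb"
  let ?K = "critical_cone \<Theta> zb b"
  let ?S = "second_order_critical_set \<Theta> zb b"
  define d where "d t = (1 / t) *\<^sub>R (closest_point \<Theta> (zb + b + t *\<^sub>R h) - zb)" for t :: real
  have proj: "closest_point \<Theta> (zb + b + t *\<^sub>R h) = zb + t *\<^sub>R d t" if "0 < t" for t
    using that by (simp add: d_def)
  have dmem: "zb + t *\<^sub>R d t \<in> \<Theta>" if "0 < t" for t
    unfolding proj[OF that, symmetric] using assms(1,3) by (intro closest_point_in_set) auto
  have bd: "b \<bullet> d t \<le> 0" if "0 < t" for t
  proof -
    have "b \<bullet> (zb + t *\<^sub>R d t - zb) \<le> 0"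
      using b dmem[OF that] unfolding normal_cone_def by blast
    then show ?thesis
      using that by (simp add: mult_le_0_iff)
  qed
  have pen: "2 / t * (b \<bullet> d t) \<le> 0" if "0 < t" for t
    using bd[OF that] that by (intro mult_nonneg_nonpos) auto
  have drop_penalty: "x \<le> y" if "x - c \<le> y" "c \<le> 0" for x c y :: real
    using that by simp
  have zero: "(norm (d t - h))\<^sup>2 - 2 / t * (b \<bullet> d t) \<le> (norm h)\<^sup>2" if "0 < t" for t
    using closest_point_quotient_minimises[OF assms(1) _ that proj[OF that], of 0] assms(3) by simp
  have "bounded (d ` {0<..})"
  proof (rule boundedI)
    fix x assume "x \<in> d ` {0<..}"
    then obtain t where t: "0 < t" "x = d t" by auto
    have "(norm (x - h))\<^sup>2 \<le> (norm h)\<^sup>2"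
      using drop_penalty[OF zero pen, OF t(1) t(1)] t(2) by simp
    then have "norm (x - h) \<le> norm h"
      by (rule power2_le_imp_le) simp
    then show "norm x \<le> 2 * norm h"
      using norm_triangle_sub[of x h] by linarith
  qed
  then have "(d \<longlongrightarrow> closest_point ?K h) (at_right 0)"
  proof (rule tendsto_at_right_if_unique_cluster_point)
    fix t :: "nat \<Rightarrow> real" and l
    assume t: "\<And>n. 0 < t n" "t \<longlonglongrightarrow> 0" and l: "(\<lambda>n. d (t n)) \<longlonglongrightarrow> l"
    have tr: "filterlim t (at_right 0) sequentially"
      using t by (simp add: filterlim_at less_imp_neq[symmetric])
    have "l \<in> tangent_cone \<Theta> zb"
      unfolding tangent_cone_def
      by (intro CollectI exI[of _ t] exI[of _ "\<lambda>n. d (t n)"] conjI allI dmem t l)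
    moreover have "b \<bullet> l = 0"
    proof (rule antisym)
      have lim: "(\<lambda>n. b \<bullet> d (t n)) \<longlonglongrightarrow> b \<bullet> l"
        by (intro tendsto_intros l)
      show "b \<bullet> l \<le> 0"
        using lim by (rule LIMSEQ_le_const2) (use bd t(1) in auto)
      have le: "- (t n * (norm h)\<^sup>2) \<le> 2 * (b \<bullet> d (t n))" for n
      proof -
        have "0 - 2 / t n * (b \<bullet> d (t n)) \<le> (norm (d (t n) - h))\<^sup>2 - 2 / t n * (b \<bullet> d (t n))"
          by (intro diff_right_mono) simp
        also have "\<dots> \<le> (norm h)\<^sup>2"
          by (rule zero[OF t(1)])
        finally have "- (2 / t n * (b \<bullet> d (t n))) \<le> (norm h)\<^sup>2"
          by simp
        then show ?thesis
          using t(1)[of n] by (simp add: field_simps)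
      qed
      have "(\<lambda>n. - (t n * (norm h)\<^sup>2)) \<longlonglongrightarrow> - (0 * (norm h)\<^sup>2)"
        by (intro tendsto_intros t)
      moreover have "(\<lambda>n. 2 * (b \<bullet> d (t n))) \<longlonglongrightarrow> 2 * (b \<bullet> l)"
        by (intro tendsto_intros lim)
      ultimately have "- (0 * (norm h)\<^sup>2) \<le> 2 * (b \<bullet> l)"
        using le by (intro LIMSEQ_le[where X = "\<lambda>n. - (t n * (norm h)\<^sup>2)"]) blast+
      then show "0 \<le> b \<bullet> l" by simp
    qed
    ultimately have lK: "l \<in> ?K"
      by (simp add: critical_cone_iff)
    have "dist h l \<le> dist h k" if "k \<in> ?S" for k
    proof -
      obtain e :: "real \<Rightarrow> 'a" where e: "\<And>t. 0 < t \<Longrightarrow> zb + t *\<^sub>R e t \<in> \<Theta>"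
        and lim: "((\<lambda>t. (norm (e t - h))\<^sup>2 - 2 / t * (b \<bullet> e t)) \<longlongrightarrow> (norm (k - h))\<^sup>2) (at_right 0)"
        using second_order_critical_recovery[OF assms(1,3) \<open>k \<in> ?S\<close>] by blast
      have le: "(norm (d (t n) - h))\<^sup>2
          \<le> (norm (e (t n) - h))\<^sup>2 - 2 / t n * (b \<bullet> e (t n))" for n
        by (intro drop_penalty[OF closest_point_quotient_minimises[OF assms(1) e _ proj] pen] t(1))
      have "(\<lambda>n. (norm (d (t n) - h))\<^sup>2) \<longlonglongrightarrow> (norm (l - h))\<^sup>2"
        by (intro tendsto_intros l)
      moreover note filterlim_compose[OF lim tr]
      ultimately have "(norm (l - h))\<^sup>2 \<le> (norm (k - h))\<^sup>2"
        using le by (intro LIMSEQ_le[where X = "\<lambda>n. (norm (d (t n) - h))\<^sup>2"]) blast+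
      then have "norm (l - h) \<le> norm (k - h)"
        by (rule power2_le_imp_le) simp
      then show ?thesis
        by (simp add: dist_norm norm_minus_commute)
    qed
    then have "closure ?S \<subseteq> {k. dist h l \<le> dist h k}"
      by (intro closure_minimal closed_Collect_le continuous_intros) auto
    moreover have "?K \<subseteq> closure ?S"
      using assms(5) b unfolding extended_polyhedricity_at_def by blast
    ultimately have "\<forall>k\<in>?K. dist h l \<le> dist h k"
      by blast
    then show "l = closest_point ?K h"
      using closest_point_unique[OF _ _ lK] closed_convex_critical_cone[OF assms(2,3)] by blast
  qed
  then show "has_directional_derivative (closest_point \<Theta>) (closest_point ?K h) (zb + b) h"
    unfolding has_directional_derivative_def closest_point_add_normal[OF assms(1,2) b] d_def .
qed

end
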